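(* For each $\eta\in(0,\pi/3)$, the convex hull $\mathrm{co}(K_\eta)$ of the $\eta$-dragon curve $K_\eta$ is a polygon.
   Context: For $\eta\in(0,\pi/3)$ let $a=\frac{e^{-i\eta}}{2\cos\eta}$, $f_1(z)=az$, $f_2(z)=1-\bar a z$ ($z\in\mathbb{C}$). The $\eta$-dragon curve $K_\eta$ is the unique nonempty compact set $K_\eta\subset\mathbb{C}$ with $K_\eta=f_1(K_\eta)\cup f_2(K_\eta)$. *)

theory Defs
  imports "HOL-Analysis.Analysis"
begin

definition dragon_a :: "real \<Rightarrow> complex" where
  "dragon_a \<eta> = cis (- \<eta>) / complex_of_real (2 * cos \<eta>)"

definition dragon_f1 :: "real \<Rightarrow> complex \<Rightarrow> complex" where
  "dragon_f1 \<eta> z = dragon_a \<eta> * z"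

definition dragon_f2 :: "real \<Rightarrow> complex \<Rightarrow> complex" where
  "dragon_f2 \<eta> z = 1 - cnj (dragon_a \<eta>) * z"

definition dragon :: "real \<Rightarrow> complex set" where
  "dragon \<eta> = (THE K. compact K \<and> K \<noteq> {} \<and>
                  K = dragon_f1 \<eta> ` K \<union> dragon_f2 \<eta> ` K)"

definition convex_polygon :: "complex set \<Rightarrow> bool" where
  "convex_polygon S \<longleftrightarrow> polytope S \<and> interior S \<noteq> {}"

end

theory Submission
  imports Defs
begin

text \<open>
  Put \<open>R = \<bar>a\<bar>\<^sup>2\<close>. Since \<open>Re a = 1/2\<close>, every real-linear functional of \<open>a ^ k\<close> satisfies
  \<open>x (k + 2) = x (k + 1) - R x k\<close>. Let \<open>p\<close> be the fixed point of \<open>f\<^sub>2 f\<^sub>2 f\<^sub>1 f\<^sub>1\<close>, and let \<open>W\<close> consist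
  of the points \<open>f\<^sub>1\<^sup>n p\<close>, \<open>f\<^sub>2 f\<^sub>1\<^sup>n p\<close> and \<open>f\<^sub>2 f\<^sub>2 f\<^sub>1 p\<close>, all of which lie in the dragon curve. Comparing
  support functions by means of the recurrence shows that \<open>f\<^sub>1\<close> and \<open>f\<^sub>2\<close> map \<open>W\<close> into its convex hull, so
  this hull contains the dragon curve. The two sequences in \<open>W\<close> spiral around their limits \<open>0\<close> and \<open>1\<close>,
  which are therefore interior to the hull, so finitely many points of \<open>W\<close> span it.
\<close>

section \<open>The recurrence satisfied by linear functionals of powers\<close>

lemma recurrence_backward_zero:
  fixes x :: "nat \<Rightarrow> real"
  assumes rec: "\<And>k. x (k + 2) = x (k + 1) - R * x k" and "R \<noteq> 0"
    and "x k = 0" "x (k + 1) = 0"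
  shows "x 0 = 0 \<and> x 1 = 0"
  using assms(3,4)
proof (induction k)
  case (Suc k)
  then show ?case using rec[of k] \<open>R \<noteq> 0\<close> by simp
qed simp

text \<open>The characteristic roots are not real since \<open>R > 1/4\<close>: the quotients \<open>x (k + 1) / x k\<close>
  of a positive solution would drop by at least \<open>R - 1/4\<close> in each step.\<close>

lemma recurrence_nonneg_imp_zero:
  fixes x :: "nat \<Rightarrow> real"
  assumes rec: "\<And>k. x (k + 2) = x (k + 1) - R * x k" and R: "1 / 4 < R"
    and N: "1 < (R - 1 / 4) * real N"
    and nonneg: "\<And>k. k \<le> N + 2 \<Longrightarrow> 0 \<le> x k"
  shows "x 0 = 0 \<and> x 1 = 0"
proof -
  define e where "e = R - 1 / 4"
  have e: "0 < e" "R = e + 1 / 4" using R by (auto simp: e_def)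
  have drop: "x (k + 2) \<le> (1 - e * real k) * x (k + 1)" if "k \<le> N" for k
    using that
  proof (induction k)
    case 0
    then show ?case using rec[of 0] nonneg[of 0] R by simp
  next
    case (Suc k)
    define t where "t = e * real k"
    have t: "0 \<le> t" using e by (simp add: t_def)
    \<comment> \<open>The claim for \<open>Suc k\<close> amounts to
      \<open>(t + e) * x (k + 2) \<le> R * x (k + 1)\<close>. By the induction hypothesis it
      suffices that \<open>(t + e) * (1 - t) \<le> R\<close>, seen by completing a square.\<close>
    have "(t + e) * x (k + 2) \<le> (t + e) * ((1 - t) * x (k + 1))"
      using Suc t e by (intro mult_left_mono) (auto simp: t_def)
    also have "\<dots> = ((t + e) * (1 - t)) * x (k + 1)" by simp
    also have "\<dots> \<le> R * x (k + 1)"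
    proof (intro mult_right_mono)
      have "R - (t + e) * (1 - t) = (t - 1 / 2)\<^sup>2 + e * t"
        by (simp add: e power2_eq_square algebra_simps)
      moreover have "0 \<le> (t - 1 / 2)\<^sup>2 + e * t" using e t by simp
      ultimately show "(t + e) * (1 - t) \<le> R" by linarith
    qed (use nonneg Suc in auto)
    finally have "x (k + 2) - R * x (k + 1) \<le> (1 - (t + e)) * x (k + 2)"
      by (simp add: algebra_simps)
    then show ?case using rec[of "k + 1"] by (simp add: t_def algebra_simps)
  qed
  have "0 \<le> x (N + 2)" "0 \<le> x (N + 1)" using nonneg by auto
  moreover have "x (N + 2) \<le> (1 - e * real N) * x (N + 1)" using drop by blast
  moreover have "1 - e * real N < 0" using N by (simp add: e_def)
  ultimately have "x (N + 1) = 0" "x (N + 2) = 0"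
    by (smt (verit) mult_neg_pos mult_nonpos_nonneg)+
  then show ?thesis
    using recurrence_backward_zero[OF rec, of "N + 1"] R by simp
qed

text \<open>The signs of two consecutive terms decide the next one: a nonnegative term is followed
  by one of at least \<open>- R * M\<close>, two nonpositive terms are followed by no decrease, and
  a drop from positive to negative is controlled by going back one more step.\<close>

lemma recurrence_lower_bound:
  fixes x :: "nat \<Rightarrow> real"
  assumes rec: "\<And>k. x (k + 2) = x (k + 1) - R * x k" and R: "0 < R" "R < 1"
    and le: "\<And>k. 1 \<le> k \<Longrightarrow> x k \<le> M" and M: "0 \<le> M" and inc: "x 0 \<le> x 1"
  shows "- R * M \<le> x (k + 1) \<or> x k \<le> x (k + 1) \<and> x 1 \<le> x (k + 1)"
proof (induction k)
  case 0
  then show ?case using inc by simp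
next
  case (Suc k)
  have leM: "x j \<le> M" for j
    using le[of j] le[of 1] inc by (cases j) auto
  have RM: "R * x j \<le> R * M" for j using leM R by (intro mult_left_mono) auto
  have rec': "x (Suc k + 1) = x (k + 1) - R * x k" using rec[of k] by simp
  consider (nonneg) "0 \<le> x (k + 1)" | (rising) "x (k + 1) < 0" "x k \<le> 0"
    | (falling) "x (k + 1) < 0" "0 < x k" by linarith
  then show ?case
  proof cases
    case nonneg
    then show ?thesis using rec' RM[of k] by auto
  next
    case rising
    then have "R * x k \<le> 0" using R by (simp add: mult_le_0_iff)
    then show ?thesis using rec' Suc by auto
  next
    case falling
    \<comment> \<open>The start \<open>x 0 \<le> x 1\<close> excludes a sign drop at
      \<open>k = 0\<close>, so an earlier term exists.\<close>
    then obtain j where j: "k = Suc j" using inc by (cases k) auto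
    have "x (k + 1) = x k - R * x j" using rec[of j] by (simp add: j)
    then have "x (Suc k + 1) = (1 - R) * x k - R * x j"
      using rec' by (simp add: algebra_simps)
    moreover have "0 \<le> (1 - R) * x k" using R falling by simp
    ultimately show ?thesis using RM[of j] by simp
  qed
qed

text \<open>With \<open>x k\<close> the value of a functional at \<open>a ^ k\<close>, the left side
  is its value at \<open>f (Q k)\<close> times \<open>1 - R\<^sup>2\<close>. Either
  \<open>x (k + 1)\<close> is at least \<open>- R * M\<close>, and the weights
  \<open>1 - R\<^sup>2\<close> and \<open>R\<^sup>2\<close> add up to 1, or \<open>x (k + 1)\<close>
  may be replaced by \<open>x 1\<close>.\<close>

lemma recurrence_support_bound:
  fixes x :: "nat \<Rightarrow> real"
  assumes rec: "\<And>k. x (k + 2) = x (k + 1) - R * x k" and R: "0 < R" "R < 1"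
    and le: "\<And>k. 1 \<le> k \<Longrightarrow> x k \<le> M" and M: "0 \<le> M" and inc: "x 0 \<le> x 1"
  shows "(1 - R\<^sup>2) * x 1 - R * x (k + 1) \<le> M"
proof -
  have R2: "0 \<le> 1 - R\<^sup>2" using R by (simp add: power_le_one)
  consider "- R * M \<le> x (k + 1)" | "x 1 \<le> x (k + 1)"
    using recurrence_lower_bound[OF assms, of k] by blast
  then show ?thesis
  proof cases
    case 1
    then have "R * (- R * M) \<le> R * x (k + 1)" using R by (intro mult_left_mono) auto
    moreover have "(1 - R\<^sup>2) * x 1 \<le> (1 - R\<^sup>2) * M" using R2 le by (intro mult_left_mono) auto
    ultimately show ?thesis by (simp add: power2_eq_square algebra_simps)
  next
    case 2
    have "x 2 = x 1 - R * x 0" "x 3 = x 2 - R * x 1" "x 4 = x 3 - R * x 2"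
      using rec[of 0] rec[of 1] rec[of 2] by (simp_all add: numeral_eq_Suc)
    then have x4: "x 4 = (1 - 2 * R) * x 1 - R * (1 - R) * x 0"
      by (simp only:) (simp add: algebra_simps)
    have "R * x 1 \<le> R * x (k + 1)" using 2 R by simp
    \<comment> \<open>For \<open>x 1 \<ge> 0\<close> comparison with \<open>x 1\<close> is enough;
      for \<open>x 1 < 0\<close> the term to compare with is \<open>x 4\<close>.\<close>
    moreover have "(1 - R\<^sup>2) * x 1 - R * x 1 \<le> M"
    proof (cases "0 \<le> x 1")
      case True
      then have "0 \<le> R\<^sup>2 * x 1" "0 \<le> R * x 1" using R by auto
      then show ?thesis using le[of 1] by (simp add: algebra_simps)
    next
      case False
      then have "0 \<le> R * (1 - R) * (- x 0 - x 1)" using R inc by simp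
      then show ?thesis using le[of 4] x4 by (simp add: power2_eq_square algebra_simps)
    qed
    ultimately show ?thesis by linarith
  qed
qed

text \<open>The estimate for \<open>g (Q 0)\<close>, the square of \<open>g\<close> at
  \<open>P 1\<close>. The plane of pairs \<open>(x 0, x 1)\<close> is cut into four cones, on which
  the comparison is with \<open>P 1\<close>, \<open>Q 2\<close>, \<open>Q 3\<close> and
  \<open>B\<close> in turn.\<close>

lemma recurrence_support_bound_square:
  fixes x :: "nat \<Rightarrow> real"
  assumes rec: "\<And>k. x (k + 2) = x (k + 1) - R * x k" and R: "0 < R" "R < 1"
    and P: "\<And>k. 1 \<le> k \<Longrightarrow> x k \<le> M" and M: "0 \<le> M"
    and Q: "\<And>k. (1 - R\<^sup>2) * x 0 - R * x k \<le> M"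
    and B: "(1 - R\<^sup>2) * x 1 + R\<^sup>2 * x 0 \<le> M"
  shows "(1 - R\<^sup>2) * x 1 + R * (x 0 - x 1) \<le> M"
proof -
  have R2: "0 \<le> 1 - R\<^sup>2" using R by (simp add: power_le_one)
  have x2: "x 2 = x 1 - R * x 0" using rec[of 0] by (simp add: numeral_eq_Suc)
  have x3: "x 3 = (1 - R) * x 1 - R * x 0"
    using rec[of 0] rec[of 1] by (simp add: numeral_eq_Suc algebra_simps)
  consider "x 0 \<le> x 1" | "x 1 < x 0" "x 1 < 0" | "0 \<le> x 1" "x 1 \<le> (1 - R) * x 0"
    | "(1 - R) * x 0 \<le> x 1" by linarith
  then show ?thesis
  proof cases
    case 1
    then have "R * (x 0 - x 1) \<le> 0" using R by (simp add: mult_le_0_iff)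
    moreover have "(1 - R\<^sup>2) * x 1 \<le> (1 - R\<^sup>2) * M" using R2 P by (intro mult_left_mono) auto
    moreover have "0 \<le> R\<^sup>2 * M" using M by simp
    ultimately show ?thesis by (simp add: algebra_simps)
  next
    case 2
    then have "R * x 1 < 0" using R by (simp add: mult_less_0_iff)
    then have "0 \<le> (1 - R) * (x 0 - x 1 - R * x 1)" using R 2 by simp
    then show ?thesis using Q[of 2] x2 by (simp add: power2_eq_square algebra_simps)
  next
    case 3
    then have "0 \<le> 2 * R\<^sup>2 * x 1" by simp
    then show ?thesis using Q[of 3] x3 3 by (simp add: power2_eq_square algebra_simps)
  next
    case 4
    then have "0 \<le> R * (x 1 - (1 - R) * x 0)" using R by simp
    then show ?thesis using B by (simp add: power2_eq_square algebra_simps)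
  qed
qed

text \<open>The estimate for \<open>g B\<close>, the cube of \<open>g\<close> at \<open>P 2\<close>.
  The five cases compare with \<open>Q 3\<close>, \<open>Q 1\<close>, \<open>P 1\<close>,
  \<open>P 2\<close> and \<open>P 3\<close> in turn.\<close>

lemma recurrence_support_bound_cube:
  fixes x :: "nat \<Rightarrow> real"
  assumes rec: "\<And>k. x (k + 2) = x (k + 1) - R * x k" and R: "0 < R" "R < 1"
    and P: "\<And>k. 1 \<le> k \<Longrightarrow> x k \<le> M"
    and Q: "\<And>k. (1 - R\<^sup>2) * x 0 - R * x k \<le> M"
  shows "(1 - R\<^sup>2) * (1 - R) * x 0 - R\<^sup>2 * (x 0 - x 1) \<le> M"
proof -
  have R2: "0 \<le> 1 - R\<^sup>2" using R by (simp add: power_le_one)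
  have x2: "x 2 = x 1 - R * x 0" using rec[of 0] by (simp add: numeral_eq_Suc)
  have x3: "x 3 = (1 - R) * x 1 - R * x 0"
    using rec[of 0] rec[of 1] by (simp add: numeral_eq_Suc algebra_simps)
  have R12: "0 \<le> 1 + R - R\<^sup>2" using R2 R by simp
  consider "x 1 \<le> x 0" "0 \<le> x 0" | "x 1 \<le> x 0" "x 0 < 0"
    | "x 0 \<le> x 1" "0 \<le> x 0" | "x 0 \<le> 0" "0 \<le> x 1" | "x 0 \<le> x 1" "x 1 \<le> 0" by linarith
  then show ?thesis
  proof cases
    case 1
    then have "0 \<le> R * (R * (2 - R) * x 0 + (x 0 - x 1))" using R by simp
    then show ?thesis using Q[of 3] x3 by (simp add: power2_eq_square algebra_simps)
  next
    case 2
    then have "0 \<le> R * ((1 + R) * (x 0 - x 1) + R\<^sup>2 * (- x 0))"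
      using R by (intro mult_nonneg_nonneg add_nonneg_nonneg) auto
    then show ?thesis using Q[of 1] by (simp add: power2_eq_square algebra_simps)
  next
    case 3
    then have "(1 - R\<^sup>2) * (1 - R) * x 0 \<le> (1 - R\<^sup>2) * 1 * x 1"
      using R R2 by (intro mult_mono) auto
    moreover have "0 \<le> R\<^sup>2 * x 0" using 3 by simp
    ultimately show ?thesis using P[of 1] by (simp add: algebra_simps)
  next
    case 4
    then have "0 \<le> (1 - R\<^sup>2) * x 1 + (1 - R) * (1 + R - R\<^sup>2) * (- x 0)"
      using R R2 R12 by (intro add_nonneg_nonneg mult_nonneg_nonneg) auto
    then show ?thesis using P[of 2] x2 by (simp add: power2_eq_square algebra_simps)
  next
    case 5
    have "0 \<le> (1 - R) * (1 + R - R\<^sup>2) * (x 1 - x 0)"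
      using R R12 5 by simp
    moreover have "0 \<le> R * (1 - R + R\<^sup>2) * (- x 1)"
      using R 5 by (intro mult_nonneg_nonneg) auto
    ultimately show ?thesis using P[of 3] x3 by (simp add: power2_eq_square algebra_simps)
  qed
qed

section \<open>Convexity and attractors\<close>

lemma mem_closed_convex_by_support:
  fixes H :: "'a::euclidean_space set"
  assumes "convex H" "closed H"
    and le: "\<And>u c. (\<And>h. h \<in> H \<Longrightarrow> u \<bullet> h \<le> c) \<Longrightarrow> u \<bullet> y \<le> c"
  shows "y \<in> H"
proof (rule ccontr)
  assume "y \<notin> H"
  then obtain u c where uc: "u \<bullet> y < c" "\<And>h. h \<in> H \<Longrightarrow> c < u \<bullet> h"
    using separating_hyperplane_closed_point[OF assms(1,2)] by blast
  then have "(- u) \<bullet> y \<le> - c" by (intro le) (simp add: less_imp_le)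
  then show False using uc by simp
qed

text \<open>A functional separating \<open>0\<close> from the interior is nonnegative on all of
  \<open>C\<close>, because a convex set with nonempty interior lies in the closure of that
  interior. The assumption \<open>const\<close> keeps \<open>C\<close> from lying in a
  hyperplane.\<close>

lemma zero_in_interior_convex:
  fixes C :: "'a::euclidean_space set"
  assumes "convex C"
    and const: "\<And>u c. (\<And>y. y \<in> C \<Longrightarrow> u \<bullet> y = c) \<Longrightarrow> u = 0"
    and nonneg: "\<And>u. (\<And>y. y \<in> C \<Longrightarrow> 0 \<le> u \<bullet> y) \<Longrightarrow> u = 0"
  shows "0 \<in> interior C"
proof (rule ccontr)
  assume "0 \<notin> interior C"
  then obtain u where u: "u \<noteq> 0" "\<And>y. y \<in> interior C \<Longrightarrow> 0 \<le> u \<bullet> y"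
    using separating_hyperplane_set_0[of "interior C"] \<open>convex C\<close> convex_interior by blast
  have "interior C \<noteq> {}"
  proof
    assume "interior C = {}"
    then obtain v c where "v \<noteq> 0" "C \<subseteq> {y. v \<bullet> y = c}"
      using empty_interior_subset_hyperplane[OF \<open>convex C\<close>] by metis
    then show False using const[of v c] by auto
  qed
  then have "closure (interior C) = closure C"
    using \<open>convex C\<close> by (simp add: convex_closure_interior)
  moreover have "closure (interior C) \<subseteq> {y. 0 \<le> u \<bullet> y}"
    using u by (intro closure_minimal) (auto simp: closed_halfspace_ge)
  ultimately have "0 \<le> u \<bullet> y" if "y \<in> C" for y
    using that closure_subset by blast
  then show False using nonneg[of u] u(1) by simp
qed

lemma contraction_infdist_le:
  assumes "L \<noteq> {}" "f ` L \<subseteq> L" "0 \<le> c"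
    and lip: "\<And>x y. dist (f x) (f y) \<le> c * dist x y"
  shows "infdist (f w) L \<le> c * infdist w L"
\<comment> \<open>The general case divides by \<open>c\<close>.\<close>
proof (cases "c = 0")
  case True
  obtain l where "l \<in> L" using \<open>L \<noteq> {}\<close> by blast
  then have "f l \<in> L" "dist (f w) (f l) \<le> 0" using assms True by auto
  then show ?thesis using infdist_le[of "f l" L "f w"] True by simp
next
  case False
  have "infdist (f w) L / c \<le> dist w l" if "l \<in> L" for l
  proof -
    have "infdist (f w) L \<le> dist (f w) (f l)" using that assms by (intro infdist_le) auto
    also have "\<dots> \<le> c * dist w l" by (rule lip)
    finally show ?thesis using False \<open>0 \<le> c\<close> by (simp add: field_simps)
  qed
  then have "infdist (f w) L / c \<le> infdist w L"
    using \<open>L \<noteq> {}\<close> by (auto simp: infdist_def intro: cINF_greatest)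
  then show ?thesis using False \<open>0 \<le> c\<close> by (simp add: field_simps)
qed

text \<open>A point of \<open>K\<close> farthest from \<open>L\<close> is the image of some point of
  \<open>K\<close>, so the maximal distance is at most \<open>c\<close> times itself and vanishes.
  This serves both for uniqueness of the attractor and for enclosing it in the polygon.\<close>

lemma compact_self_covering_subset:
  fixes f g :: "'a::metric_space \<Rightarrow> 'a"
  assumes K: "compact K" "K \<subseteq> f ` K \<union> g ` K"
    and L: "closed L" "L \<noteq> {}" "f ` L \<subseteq> L" "g ` L \<subseteq> L"
    and c: "0 \<le> c" "c < 1"
    and lip: "\<And>x y. dist (f x) (f y) \<le> c * dist x y" "\<And>x y. dist (g x) (g y) \<le> c * dist x y"
  shows "K \<subseteq> L"
proof (cases "K = {}")
  case False
  have "continuous_on K (\<lambda>z. infdist z L)" by (intro continuous_intros)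
  then obtain z where z: "z \<in> K" "\<And>y. y \<in> K \<Longrightarrow> infdist y L \<le> infdist z L"
    using continuous_attains_sup[OF K(1) False] by blast
  obtain w where "w \<in> K" "z = f w \<or> z = g w" using z(1) K(2) by blast
  then have "infdist z L \<le> c * infdist w L"
    using contraction_infdist_le[OF L(2,3) c(1) lip(1)]
      contraction_infdist_le[OF L(2,4) c(1) lip(2)] by auto
  also have "\<dots> \<le> c * infdist z L" using z \<open>w \<in> K\<close> c by (intro mult_left_mono) auto
  finally have "(1 - c) * infdist z L \<le> 0" by (simp add: algebra_simps)
  then have "infdist z L \<le> 0" using c by (simp add: mult_le_0_iff)
  then have "infdist y L = 0" if "y \<in> K" for y
    using z(2)[OF that] infdist_nonneg[of y L] by linarith
  then show ?thesis using in_closed_iff_infdist_zero[OF L(1,2)] by blast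
qed simp

inductive_set orbit2 :: "('a \<Rightarrow> 'a) \<Rightarrow> ('a \<Rightarrow> 'a) \<Rightarrow> 'a \<Rightarrow> 'a set" for f g p where
  base: "p \<in> orbit2 f g p"
| left: "z \<in> orbit2 f g p \<Longrightarrow> f z \<in> orbit2 f g p"
| right: "z \<in> orbit2 f g p \<Longrightarrow> g z \<in> orbit2 f g p"

text \<open>The invariant compact set \<open>H\<close> makes the closure compact. Since
  \<open>p\<close> is itself an image of an orbit point, the orbit is covered by its two images, and
  compactness of the images carries this over to the closure.\<close>

lemma closure_orbit2_self_similar:
  fixes f g :: "'a::metric_space \<Rightarrow> 'a"
  assumes H: "compact H" "p \<in> H" "f ` H \<subseteq> H" "g ` H \<subseteq> H"
    and cont: "continuous_on UNIV f" "continuous_on UNIV g"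
    and p: "p \<in> f ` orbit2 f g p \<union> g ` orbit2 f g p"
  defines "K \<equiv> closure (orbit2 f g p)"
  shows "compact K \<and> K \<noteq> {} \<and> K = f ` K \<union> g ` K"
proof -
  let ?O = "orbit2 f g p"
  have "z \<in> H" if "z \<in> ?O" for z using that by induction (use H in auto)
  then have "K \<subseteq> H"
    unfolding K_def by (intro closure_minimal compact_imp_closed H) auto
  then have K: "compact K"
    using H by (metis K_def closed_closure compact_Int_closed inf.absorb_iff2)
  have "f ` K \<subseteq> K" "g ` K \<subseteq> K" unfolding K_def
    by (intro image_closure_subset continuous_on_subset[OF cont(1)] continuous_on_subset[OF cont(2)];
        use closure_subset in \<open>fastforce intro: orbit2.intros\<close>)+
  moreover have "z \<in> f ` ?O \<union> g ` ?O" if "z \<in> ?O" for z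
    using that by induction (use p in auto)
  then have "?O \<subseteq> f ` K \<union> g ` K" unfolding K_def using closure_subset by blast
  then have "K \<subseteq> f ` K \<union> g ` K"
    unfolding K_def[symmetric] using K cont
    by (subst K_def) (intro closure_minimal compact_imp_closed compact_Un
        compact_continuous_image continuous_on_subset[OF cont(1)] continuous_on_subset[OF cont(2)]; simp)
  moreover have "K \<noteq> {}" unfolding K_def using orbit2.base by fastforce
  ultimately show ?thesis using K by blast
qed

section \<open>The polygon\<close>

text \<open>Stated for preimages so that \<open>hull_minimal\<close> applies: an affine map sends a
  hull into \<open>H\<close> once it sends the generators there.\<close>

lemma convex_affine_vimage:
  fixes H :: "'a::real_algebra_1 set"
  assumes "convex H"
  shows "convex {z. c + d * z \<in> H}"
proof (rule convexI)
  fix x y and u v :: real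
  assume *: "x \<in> {z. c + d * z \<in> H}" "y \<in> {z. c + d * z \<in> H}" "0 \<le> u" "0 \<le> v" "u + v = 1"
  have "c = u *\<^sub>R c + v *\<^sub>R c" using * by (metis scaleR_left_distrib scaleR_one)
  then have "c + d * (u *\<^sub>R x + v *\<^sub>R y) = u *\<^sub>R (c + d * x) + v *\<^sub>R (c + d * y)"
    by (simp add: algebra_simps)
  also have "\<dots> \<in> H" using * by (intro convexD[OF assms]) auto
  finally show "u *\<^sub>R x + v *\<^sub>R y \<in> {z. c + d * z \<in> H}" by simp
qed

text \<open>\<open>Re a = 1 / 2\<close> means \<open>a + cnj a = 1\<close>, the source of the
  recurrence; \<open>Im a \<noteq> 0\<close> gives \<open>R > 1/4\<close>; \<open>norm a < 1\<close>
  makes both maps contractions.\<close>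

locale dragon_parameter =
  fixes a :: complex
  assumes Re_a: "Re a = 1 / 2" and Im_a: "Im a \<noteq> 0" and norm_a: "norm a < 1"
begin

definition R :: real where "R = (norm a)\<^sup>2"

text \<open>The composite of \<open>f\<close>, \<open>f\<close>, \<open>g\<close>, \<open>g\<close>
  sends \<open>z\<close> to \<open>a + R\<^sup>2 * z\<close>, so its fixed point is
  \<open>b * a\<close>.\<close>

definition b :: real where "b = 1 / (1 - R\<^sup>2)"

definition f :: "complex \<Rightarrow> complex" where "f z = a * z"

definition g :: "complex \<Rightarrow> complex" where "g z = 1 - cnj a * z"

text \<open>\<open>P 1\<close> is the fixed point of \<open>g \<circ> g \<circ> f \<circ> f\<close>, and \<open>P (n + 1)\<close>, \<open>Q n\<close>, \<open>B\<close> are its images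
  under \<open>f ^^ n\<close>, \<open>g \<circ> f ^^ n\<close> and \<open>g \<circ> g \<circ> f\<close>.\<close>

definition P :: "nat \<Rightarrow> complex" where "P n = of_real b * a ^ n"

definition Q :: "nat \<Rightarrow> complex" where "Q n = 1 - of_real (R * b) * a ^ n"

definition B :: complex where "B = a + of_real (R\<^sup>2 * b)"

text \<open>The set \<open>W\<close> of the introduction; \<open>P\<close> starts at index 1 because
  \<open>P 1\<close> is the fixed point \<open>p\<close>.\<close>

definition candidates :: "complex set" where
  "candidates = P ` {1..} \<union> range Q \<union> {B}"

section \<open>Action of the two maps on the candidates\<close>

lemma R_bounds: "1 / 4 < R" "0 < R" "R < 1" "R\<^sup>2 < 1"
proof -
  have "R = (Re a)\<^sup>2 + (Im a)\<^sup>2" by (simp add: R_def cmod_power2)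
  moreover have "0 < (Im a)\<^sup>2" using Im_a by simp
  ultimately show "1 / 4 < R" by (simp add: Re_a power2_eq_square)
  then show "0 < R" by simp
  show "R < 1" unfolding R_def using norm_a by (simp add: power_less_one_iff)
  with \<open>0 < R\<close> show "R\<^sup>2 < 1" by (simp add: power_less_one_iff)
qed

lemma b_pos: "0 < b" and b_eq: "(1 - R\<^sup>2) * b = 1"
  using R_bounds by (auto simp: b_def)

lemma b_eq': "b = 1 + R\<^sup>2 * b"
  using b_eq by (simp add: algebra_simps)

lemma cnj_a: "cnj a = 1 - a"
  by (simp add: complex_eq_iff Re_a)

lemma cnj_a_mult: "cnj a * a = of_real R"
  using complex_norm_square[of a] by (simp add: R_def mult.commute)

lemma a_square: "a * a = a - of_real R"
  using cnj_a_mult by (simp add: cnj_a algebra_simps)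

lemma f_P: "f (P n) = P (n + 1)"
  by (simp add: f_def P_def)

lemma g_P: "g (P (n + 1)) = Q n"
proof -
  have "g (P (n + 1)) = 1 - of_real b * (cnj a * a) * a ^ n"
    by (simp add: g_def P_def)
  then show ?thesis by (simp only: cnj_a_mult) (simp add: Q_def mult.commute)
qed

lemma f_Q: "f (Q n) = a - of_real (R * b) * a ^ (n + 1)"
  by (simp add: f_def Q_def algebra_simps)

lemma g_Q: "g (Q (n + 1)) = a + of_real (R\<^sup>2 * b) * a ^ n"
proof -
  have "g (Q (n + 1)) = 1 - cnj a + of_real (R * b) * (cnj a * a) * a ^ n"
    by (simp add: g_def Q_def algebra_simps)
  then show ?thesis by (simp only: cnj_a_mult) (simp add: cnj_a power2_eq_square)
qed

lemma g_Q_0: "g (Q 0) = a + of_real (R * b) * (1 - a)"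
  by (simp add: g_def Q_def cnj_a algebra_simps)

lemma g_Q_1: "g (Q 1) = B"
  using g_Q[of 0] by (simp add: B_def)

text \<open>This closes the cycle from \<open>P 1\<close> through \<open>P 2\<close>,
  \<open>P 3\<close> and \<open>Q 2\<close> back to \<open>P 1\<close>; the value of
  \<open>b\<close> is chosen for it.\<close>

lemma g_Q_2: "g (Q 2) = P 1"
proof -
  have "g (Q 2) = of_real (1 + R\<^sup>2 * b) * a"
    using g_Q[of 1] by (simp add: algebra_simps numeral_2_eq_2)
  then show ?thesis by (simp only: b_eq'[symmetric]) (simp add: P_def)
qed

lemma f_B: "f B = a ^ 2 + of_real (R\<^sup>2 * b) * a"
  by (simp add: f_def B_def algebra_simps power2_eq_square)

lemma g_B: "g B = of_real (1 - R) - of_real (R\<^sup>2 * b) * (1 - a)"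
proof -
  have "g B = 1 - cnj a * a - of_real (R\<^sup>2 * b) * cnj a"
    by (simp add: g_def B_def algebra_simps)
  then show ?thesis by (simp only: cnj_a_mult) (simp add: cnj_a)
qed

lemma fixed_point: "g (g (f (f (P 1)))) = P 1"
  using g_P[of 2] g_Q_2 by (simp add: f_P numeral_eq_Suc)

section \<open>Hulls of powers and a finite spanning set\<close>

lemma inner_power_recurrence:
  "u \<bullet> a ^ (k + 2) = u \<bullet> a ^ (k + 1) - R * (u \<bullet> a ^ k)"
proof -
  have "a ^ (k + 2) = (a - of_real R) * a ^ k"
    using a_square by (simp add: mult.assoc[symmetric])
  then have "a ^ (k + 2) = a ^ (k + 1) - R *\<^sub>R a ^ k"
    by (simp add: algebra_simps scaleR_conv_of_real)
  then show ?thesis by (simp add: inner_diff_right)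
qed

text \<open>No nonzero functional is nonnegative on a long initial segment of the powers, so
  \<open>0\<close> is interior to the hull of that segment. As the powers tend to \<open>0\<close>,
  all but finitely many lie in this interior.\<close>

lemma zero_in_interior_hull_powers:
  obtains m where "0 \<in> interior (convex hull ((\<lambda>k. a ^ k) ` {..m}))"
    and "\<And>n. a ^ n \<in> convex hull ((\<lambda>k. a ^ k) ` {..m})"
proof -
  obtain N where "1 / (R - 1 / 4) < real N" using reals_Archimedean2 by blast
  then have N: "1 < (R - 1 / 4) * real N" using R_bounds by (simp add: field_simps)
  define C where "C = convex hull ((\<lambda>k. a ^ k) ` {..N + 2})"
  have in_C: "a ^ k \<in> C" if "k \<le> N + 2" for k
    unfolding C_def using that by (intro hull_inc) auto
  have zero: "u = 0" if "\<And>k. k \<le> N + 2 \<Longrightarrow> 0 \<le> u \<bullet> a ^ k" for u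
  proof -
    have "u \<bullet> a ^ 0 = 0 \<and> u \<bullet> a ^ 1 = 0"
      using recurrence_nonneg_imp_zero[of "\<lambda>k. u \<bullet> a ^ k", OF inner_power_recurrence R_bounds(1) N]
        that by blast
    then have "Re u = 0" "Im u * Im a = 0" by (auto simp: inner_complex_def)
    then show "u = 0" using Im_a by (simp add: complex_eq_iff)
  qed
  have "0 \<in> interior C"
  proof (rule zero_in_interior_convex)
    show "convex C" by (simp add: C_def)
    show "u = 0" if "\<And>y. y \<in> C \<Longrightarrow> 0 \<le> u \<bullet> y" for u
      using zero that in_C by blast
    show "u = 0" if "\<And>y. y \<in> C \<Longrightarrow> u \<bullet> y = c" for u c
    proof -
      have c: "u \<bullet> a ^ k = c" if "k \<le> N + 2" for k
        using that in_C \<open>\<And>y. y \<in> C \<Longrightarrow> u \<bullet> y = c\<close> by blast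
      \<comment> \<open>For constant values the recurrence reads
        \<open>c = c - R * c\<close>.\<close>
      have "R * c = 0"
        using inner_power_recurrence[of u 0] c[of 0] c[of 1] c[of 2]
        by (simp add: power2_eq_square)
      then have "c = 0" using R_bounds by simp
      then show "u = 0" using zero c by simp
    qed
  qed
  moreover have "(\<lambda>n. a ^ n) \<longlonglongrightarrow> 0" using norm_a by (rule LIMSEQ_power_zero)
  ultimately have "\<forall>\<^sub>F n in sequentially. a ^ n \<in> interior C"
    by (intro topological_tendstoD) auto
  then obtain n0 where n0: "\<And>n. n \<ge> n0 \<Longrightarrow> a ^ n \<in> interior C"
    by (auto simp: eventually_sequentially)
  define m where "m = max (N + 2) n0"
  have C_sub: "C \<subseteq> convex hull ((\<lambda>k. a ^ k) ` {..m})"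
    unfolding C_def m_def by (intro hull_mono image_mono) auto
  show ?thesis
  proof
    show "0 \<in> interior (convex hull ((\<lambda>k. a ^ k) ` {..m}))"
      using \<open>0 \<in> interior C\<close> interior_mono[OF C_sub] by blast
    show "a ^ n \<in> convex hull ((\<lambda>k. a ^ k) ` {..m})" for n
    proof (cases "n \<le> m")
      case True
      then show ?thesis by (intro hull_inc) auto
    next
      case False
      then have "a ^ n \<in> interior C" by (intro n0) (simp add: m_def)
      then show ?thesis using interior_subset[of C] C_sub by blast
    qed
  qed
qed

text \<open>\<open>P (k + 1)\<close> and \<open>Q k\<close> are affine images of
  \<open>a ^ k\<close>, so the result on powers transfers to both sequences. The first affine map
  fixes \<open>0\<close>; the second turns an open neighbourhood of \<open>0\<close> into one of
  \<open>1\<close>, which provides interior points.\<close>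

lemma finitely_many_candidates_suffice:
  obtains V where "finite V" "V \<subseteq> candidates" "candidates \<subseteq> convex hull V"
    "0 \<in> convex hull V" "interior (convex hull V) \<noteq> {}"
proof -
  obtain m where m: "0 \<in> interior (convex hull ((\<lambda>k. a ^ k) ` {..m}))"
      "\<And>n. a ^ n \<in> convex hull ((\<lambda>k. a ^ k) ` {..m})"
    using zero_in_interior_hull_powers by blast
  define C where "C = convex hull ((\<lambda>k. a ^ k) ` {..m})"
  note m = m[folded C_def]
  define V where "V = P ` {1..m + 1} \<union> Q ` {..m} \<union> {B}"
  have "C \<subseteq> {z. 0 + (of_real b * a) * z \<in> convex hull V}" unfolding C_def
  proof (intro hull_minimal convex_affine_vimage convex_convex_hull)
    show "(\<lambda>k. a ^ k) ` {..m} \<subseteq> {z. 0 + (of_real b * a) * z \<in> convex hull V}"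
    proof clarify
      fix k assume "k \<le> m"
      then have "P (k + 1) \<in> convex hull V" by (intro hull_inc) (auto simp: V_def)
      then show "0 + (of_real b * a) * a ^ k \<in> convex hull V" by (simp add: P_def mult.assoc)
    qed
  qed
  then have CP: "of_real b * a * z \<in> convex hull V" if "z \<in> C" for z using that by auto
  have "C \<subseteq> {z. 1 + (- of_real (R * b)) * z \<in> convex hull V}" unfolding C_def
  proof (intro hull_minimal convex_affine_vimage convex_convex_hull)
    show "(\<lambda>k. a ^ k) ` {..m} \<subseteq> {z. 1 + (- of_real (R * b)) * z \<in> convex hull V}"
    proof clarify
      fix k assume "k \<le> m"
      then have "Q k \<in> convex hull V" by (intro hull_inc) (auto simp: V_def)
      then show "1 + (- of_real (R * b)) * a ^ k \<in> convex hull V" by (simp add: Q_def)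
    qed
  qed
  then have CQ: "1 - of_real (R * b) * z \<in> convex hull V" if "z \<in> C" for z using that by auto
  show ?thesis
  proof
    show "finite V" "V \<subseteq> candidates" by (auto simp: V_def candidates_def)
    have "P n \<in> convex hull V" if n: "1 \<le> n" for n
    proof -
      obtain k where "n = Suc k" using n by (cases n) auto
      then show ?thesis using CP[OF m(2)[of k]] by (simp add: P_def mult.assoc)
    qed
    moreover have "Q n \<in> convex hull V" for n using CQ[OF m(2)] by (simp add: Q_def)
    moreover have "B \<in> convex hull V" by (intro hull_inc) (simp add: V_def)
    ultimately show "candidates \<subseteq> convex hull V" by (auto simp: candidates_def)
    have "0 \<in> C" using m(1) interior_subset by blast
    then show "0 \<in> convex hull V" using CP by fastforce
    let ?h = "\<lambda>z. 1 + (- (R * b)) *\<^sub>R z"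
    have "open (?h ` interior C)"
      using R_bounds b_pos by (intro open_affinity) auto
    moreover have "?h ` interior C \<subseteq> convex hull V"
      using CQ interior_subset by (force simp: scaleR_conv_of_real)
    ultimately have "?h ` interior C \<subseteq> interior (convex hull V)"
      by (simp add: interior_maximal)
    then show "interior (convex hull V) \<noteq> {}" using m(1) by blast
  qed
qed

text \<open>Reduces membership to the real inequalities on recurrences: \<open>x k\<close> stands
  for \<open>u \<bullet> a ^ k\<close> and \<open>M\<close> for \<open>(1 - R\<^sup>2) * c\<close>,
  where the factor clears the denominator of \<open>b\<close>. The premises on \<open>M\<close> say
  that \<open>P k\<close>, \<open>0\<close>, \<open>Q k\<close> and \<open>B\<close> satisfy the
  bound \<open>c\<close>.\<close>

lemma mem_by_scaled_support:
  assumes H: "convex H" "closed H" "candidates \<subseteq> H" "0 \<in> H"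
    and le: "\<And>x M. (\<And>k. x (k + 2) = x (k + 1) - R * x k) \<Longrightarrow>
        (\<And>k. 1 \<le> k \<Longrightarrow> x k \<le> M) \<Longrightarrow> 0 \<le> M \<Longrightarrow>
        (\<And>k. (1 - R\<^sup>2) * x 0 - R * x k \<le> M) \<Longrightarrow>
        (1 - R\<^sup>2) * x 1 + R\<^sup>2 * x 0 \<le> M \<Longrightarrow> F x \<le> M"
    and F: "\<And>u. (1 - R\<^sup>2) * (u \<bullet> y) = F (\<lambda>k. u \<bullet> a ^ k)"
  shows "y \<in> H"
proof (rule mem_closed_convex_by_support[OF H(1,2)])
  fix u c assume uc: "\<And>h. h \<in> H \<Longrightarrow> u \<bullet> h \<le> c"
  have cand: "(1 - R\<^sup>2) * (u \<bullet> h) \<le> (1 - R\<^sup>2) * c" if "h \<in> candidates" for h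
    using that H uc R_bounds by (intro mult_left_mono) auto
  have sR: "u \<bullet> (of_real t * z) = t * (u \<bullet> z)" for t z
    by (simp add: scaleR_conv_of_real[symmetric])
  have "(1 - R\<^sup>2) * (u \<bullet> y) \<le> (1 - R\<^sup>2) * c" unfolding F
  proof (rule le)
    show "u \<bullet> a ^ (k + 2) = u \<bullet> a ^ (k + 1) - R * (u \<bullet> a ^ k)" for k
      by (rule inner_power_recurrence)
    show "u \<bullet> a ^ k \<le> (1 - R\<^sup>2) * c" if "1 \<le> k" for k
    proof -
      have "(1 - R\<^sup>2) * (u \<bullet> P k) = ((1 - R\<^sup>2) * b) * (u \<bullet> a ^ k)"
        by (simp add: P_def sR)
      then show ?thesis using cand[of "P k"] that by (simp add: b_eq candidates_def)
    qed
    show "0 \<le> (1 - R\<^sup>2) * c" using uc[OF H(4)] R_bounds by simp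
    show "(1 - R\<^sup>2) * (u \<bullet> a ^ 0) - R * (u \<bullet> a ^ k) \<le> (1 - R\<^sup>2) * c" for k
    proof -
      have "(1 - R\<^sup>2) * (u \<bullet> Q k) = (1 - R\<^sup>2) * (u \<bullet> 1) - ((1 - R\<^sup>2) * b) * R * (u \<bullet> a ^ k)"
        by (simp only: Q_def inner_diff_right sR) (simp add: algebra_simps)
      then show ?thesis using cand[of "Q k"] by (simp add: b_eq candidates_def)
    qed
    show "(1 - R\<^sup>2) * (u \<bullet> a ^ 1) + R\<^sup>2 * (u \<bullet> a ^ 0) \<le> (1 - R\<^sup>2) * c"
    proof -
      have "(1 - R\<^sup>2) * (u \<bullet> B) = (1 - R\<^sup>2) * (u \<bullet> a) + ((1 - R\<^sup>2) * b) * R\<^sup>2 * (u \<bullet> 1)"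
        using sR[of "R\<^sup>2 * b" 1] by (simp add: B_def inner_add_right algebra_simps)
      then show ?thesis using cand[of B] by (simp add: b_eq candidates_def)
    qed
  qed
  then show "u \<bullet> y \<le> c" using R_bounds by simp
qed

lemma inner_scaled:
  "(1 - R\<^sup>2) * (u \<bullet> (of_real (t * b) * z)) = t * (u \<bullet> z)"
proof -
  have "(1 - R\<^sup>2) * (u \<bullet> (of_real (t * b) * z)) = ((1 - R\<^sup>2) * b) * t * (u \<bullet> z)"
    by (simp add: scaleR_conv_of_real[symmetric] del: of_real_mult)
  then show ?thesis by (simp add: b_eq)
qed

section \<open>Images of \<open>Q n\<close> and \<open>B\<close> in a closed convex set containing
  the candidates\<close>

context
  fixes H :: "complex set"
  assumes H: "convex H" "closed H" "candidates \<subseteq> H" "0 \<in> H"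
begin

lemma f_Q_mem: "f (Q n) \<in> H"
proof (rule mem_by_scaled_support[OF H, where F = "\<lambda>x. (1 - R\<^sup>2) * x 1 - R * x (n + 1)"])
  show "(1 - R\<^sup>2) * (u \<bullet> f (Q n)) = (1 - R\<^sup>2) * (u \<bullet> a ^ 1) - R * (u \<bullet> a ^ (n + 1))" for u
    by (simp only: f_Q inner_diff_right right_diff_distrib inner_scaled power_one_right)
next
  fix x :: "nat \<Rightarrow> real" and M
  assume *: "\<And>k. x (k + 2) = x (k + 1) - R * x k" "\<And>k. 1 \<le> k \<Longrightarrow> x k \<le> M" "0 \<le> M"
    "\<And>k. (1 - R\<^sup>2) * x 0 - R * x k \<le> M"
  show "(1 - R\<^sup>2) * x 1 - R * x (n + 1) \<le> M"
  proof (cases "x 0 \<le> x 1")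
    case True
    then show ?thesis using recurrence_support_bound[OF *(1) R_bounds(2,3) *(2,3)] by blast
  next
    \<comment> \<open>Here \<open>f (Q n)\<close> is dominated by the candidate
      \<open>Q (n + 1)\<close>.\<close>
    case False
    then have "(1 - R\<^sup>2) * x 1 \<le> (1 - R\<^sup>2) * x 0" using R_bounds by (intro mult_left_mono) auto
    then show ?thesis using *(4)[of "n + 1"] by linarith
  qed
qed

text \<open>Only \<open>n = 0\<close> needs a real estimate: \<open>g (Q 1)\<close> is
  \<open>B\<close>, and \<open>g (Q (k + 2))\<close> is the convex combination of \<open>P 1\<close>
  and \<open>P (k + 1)\<close> with weights \<open>1 - R\<^sup>2\<close> and
  \<open>R\<^sup>2\<close>.\<close>

lemma g_Q_mem: "g (Q n) \<in> H"
proof -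
  consider "n = 0" | "n = 1" | k where "n = k + 2"
    by (metis One_nat_def add_2_eq_Suc' not0_implies_Suc)
  then show ?thesis
  proof cases
    case 1
    show ?thesis
    proof (rule mem_by_scaled_support[OF H, where F = "\<lambda>x. (1 - R\<^sup>2) * x 1 + R * (x 0 - x 1)"])
      show "(1 - R\<^sup>2) * (u \<bullet> g (Q n)) = (1 - R\<^sup>2) * (u \<bullet> a ^ 1) + R * (u \<bullet> a ^ 0 - u \<bullet> a ^ 1)" for u
        by (simp only: 1 g_Q_0 inner_add_right inner_diff_right distrib_left inner_scaled
            power_one_right power_0)
    qed (rule recurrence_support_bound_square[OF _ R_bounds(2,3)])
  next
    case 2
    then show ?thesis using H g_Q_1 by (auto simp: candidates_def)
  next
    case 3
    show ?thesis
    proof (rule mem_by_scaled_support[OF H, where F = "\<lambda>x. (1 - R\<^sup>2) * x 1 + R\<^sup>2 * x (k + 1)"])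
      have "g (Q n) = a + of_real (R\<^sup>2 * b) * a ^ (k + 1)"
        using g_Q[of "k + 1"] 3 by (simp add: numeral_2_eq_2)
      then show "(1 - R\<^sup>2) * (u \<bullet> g (Q n)) = (1 - R\<^sup>2) * (u \<bullet> a ^ 1) + R\<^sup>2 * (u \<bullet> a ^ (k + 1))" for u
        by (simp only: inner_add_right distrib_left inner_scaled power_one_right)
    next
      fix x :: "nat \<Rightarrow> real" and M
      assume *: "\<And>k. 1 \<le> k \<Longrightarrow> x k \<le> M"
      have "(1 - R\<^sup>2) * x 1 \<le> (1 - R\<^sup>2) * M" "R\<^sup>2 * x (k + 1) \<le> R\<^sup>2 * M"
        using R_bounds * by (auto intro!: mult_left_mono)
      then show "(1 - R\<^sup>2) * x 1 + R\<^sup>2 * x (k + 1) \<le> M" by (simp add: algebra_simps)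
    qed
  qed
qed

text \<open>\<open>f B\<close> is the convex combination of \<open>P 2\<close> and
  \<open>P 1\<close> with weights \<open>1 - R\<^sup>2\<close> and \<open>R\<^sup>2\<close>.\<close>

lemma f_B_mem: "f B \<in> H"
proof (rule mem_by_scaled_support[OF H, where F = "\<lambda>x. (1 - R\<^sup>2) * x 2 + R\<^sup>2 * x 1"])
  show "(1 - R\<^sup>2) * (u \<bullet> f B) = (1 - R\<^sup>2) * (u \<bullet> a ^ 2) + R\<^sup>2 * (u \<bullet> a ^ 1)" for u
    by (simp only: f_B inner_add_right distrib_left inner_scaled power_one_right)
next
  fix x :: "nat \<Rightarrow> real" and M
  assume *: "\<And>k. 1 \<le> k \<Longrightarrow> x k \<le> M"
  have "(1 - R\<^sup>2) * x 2 \<le> (1 - R\<^sup>2) * M" "R\<^sup>2 * x 1 \<le> R\<^sup>2 * M"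
    using R_bounds * by (auto intro!: mult_left_mono)
  then show "(1 - R\<^sup>2) * x 2 + R\<^sup>2 * x 1 \<le> M" by (simp add: algebra_simps)
qed

lemma g_B_mem: "g B \<in> H"
proof (rule mem_by_scaled_support[OF H,
      where F = "\<lambda>x. (1 - R\<^sup>2) * (1 - R) * x 0 - R\<^sup>2 * (x 0 - x 1)"])
  have "u \<bullet> g B = (1 - R) * (u \<bullet> 1) - u \<bullet> (of_real (R\<^sup>2 * b) * (1 - a))" for u
    unfolding g_B inner_diff_right
    by (simp only: inner_scaleR_right[symmetric] scaleR_conv_of_real mult_1_right)
  then show "(1 - R\<^sup>2) * (u \<bullet> g B) =
      (1 - R\<^sup>2) * (1 - R) * (u \<bullet> a ^ 0) - R\<^sup>2 * (u \<bullet> a ^ 0 - u \<bullet> a ^ 1)" for u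
    by (simp only: right_diff_distrib[of "1 - R\<^sup>2" "(1 - R) * (u \<bullet> 1)"] inner_scaled
        inner_diff_right mult.assoc power_one_right power_0)
qed (rule recurrence_support_bound_cube[OF _ R_bounds(2,3)])

end

text \<open>Both maps are affine, so the generators suffice. The images of each \<open>P n\<close>
  are candidates again; the support estimates cover those of \<open>Q n\<close> and
  \<open>B\<close>.\<close>

lemma hull_invariant:
  assumes V: "finite V" "V \<subseteq> candidates" "candidates \<subseteq> convex hull V" "0 \<in> convex hull V"
  shows "f ` (convex hull V) \<subseteq> convex hull V" "g ` (convex hull V) \<subseteq> convex hull V"
proof -
  let ?H = "convex hull V"
  have H: "convex ?H" "closed ?H" "candidates \<subseteq> ?H" "0 \<in> ?H"
    using V by (auto intro: compact_imp_closed finite_imp_compact_convex_hull)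
  have f: "f z \<in> ?H" and g: "g z \<in> ?H" if z: "z \<in> candidates" for z
  proof -
    consider k where "z = P (k + 1)" | n where "z = Q n" | "z = B"
      using z by (auto simp: candidates_def) (metis Suc_le_D Suc_eq_plus1 One_nat_def)
    note cases = this
    have P: "P (k + 1) \<in> ?H" "Q k \<in> ?H" for k using V by (auto simp: candidates_def)
    show "f z \<in> ?H"
      by (rule cases; simp only: f_P P f_Q_mem[OF H] f_B_mem[OF H])
    show "g z \<in> ?H"
      by (rule cases; simp only: g_P P g_Q_mem[OF H] g_B_mem[OF H])
  qed
  have "?H \<subseteq> {z. 0 + a * z \<in> ?H}"
    using f V by (intro hull_minimal convex_affine_vimage) (auto simp: f_def)
  then show "f ` ?H \<subseteq> ?H" by (auto simp: f_def)
  have "?H \<subseteq> {z. 1 + (- cnj a) * z \<in> ?H}"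
    using g V by (intro hull_minimal convex_affine_vimage) (auto simp: g_def)
  then show "g ` ?H \<subseteq> ?H" by (auto simp: g_def)
qed

section \<open>Existence, uniqueness and hull of the attractor\<close>

lemma contractions:
  "dist (f x) (f y) \<le> norm a * dist x y" "dist (g x) (g y) \<le> norm a * dist x y"
proof -
  show "dist (f x) (f y) \<le> norm a * dist x y"
    by (simp add: f_def dist_norm norm_mult flip: right_diff_distrib)
  have "g x - g y = cnj a * (y - x)" by (simp add: g_def algebra_simps)
  then show "dist (g x) (g y) \<le> norm a * dist x y"
    by (simp add: dist_norm norm_mult norm_minus_commute)
qed

definition attractor :: "complex set \<Rightarrow> bool" where
  "attractor K \<longleftrightarrow> compact K \<and> K \<noteq> {} \<and> K = f ` K \<union> g ` K"

lemma attractor_unique: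
  assumes "attractor K" "attractor L"
  shows "K = L"
proof -
  have "K \<subseteq> L" if "attractor K" "attractor L" for K L
    by (rule compact_self_covering_subset[where f = f and g = g and c = "norm a"])
      (use that norm_a contractions in \<open>auto simp: attractor_def intro: compact_imp_closed\<close>)
  then show ?thesis using assms by blast
qed

lemma attractor_exists: "\<exists>K. attractor K"
proof -
  obtain V where V: "finite V" "V \<subseteq> candidates" "candidates \<subseteq> convex hull V" "0 \<in> convex hull V"
    using finitely_many_candidates_suffice by metis
  \<comment> \<open>The cycle through \<open>P 1\<close> exhibits it as the image of an orbit
    point.\<close>
  have "g (g (f (f (P 1)))) \<in> g ` orbit2 f g (P 1)"
    by (intro imageI orbit2.intros)
  then have "P 1 \<in> f ` orbit2 f g (P 1) \<union> g ` orbit2 f g (P 1)"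
    unfolding fixed_point by blast
  moreover have "P 1 \<in> convex hull V" using V by (auto simp: candidates_def)
  moreover have "continuous_on UNIV f" "continuous_on UNIV g"
    by (auto simp: f_def g_def intro!: continuous_intros)
  ultimately have "attractor (closure (orbit2 f g (P 1)))"
    unfolding attractor_def
    by (intro closure_orbit2_self_similar[OF finite_imp_compact_convex_hull[OF V(1)] _
          hull_invariant[OF V]])
  then show ?thesis ..
qed

text \<open>It suffices to place \<open>P 1\<close> in \<open>K\<close>, since the other candidates
  are its images. The contraction \<open>?G\<close> maps the complete set \<open>K\<close> to itself
  and so has a fixed point there.\<close>

lemma candidates_subset_attractor:
  assumes "attractor K"
  shows "candidates \<subseteq> K"
proof -
  have K: "compact K" "K \<noteq> {}" and f: "\<And>z. z \<in> K \<Longrightarrow> f z \<in> K" and g: "\<And>z. z \<in> K \<Longrightarrow> g z \<in> K"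
    using assms by (auto simp: attractor_def)
  let ?G = "\<lambda>z. g (g (f (f z)))"
  have G: "?G z = a + of_real (R\<^sup>2) * z" for z
  proof -
    have "?G z = 1 - cnj a + (cnj a * a) * (cnj a * a) * z"
      by (simp add: f_def g_def algebra_simps)
    then show ?thesis by (simp only: cnj_a_mult) (simp add: cnj_a power2_eq_square)
  qed
  have lip: "dist (?G x) (?G y) = R\<^sup>2 * dist x y" for x y
  proof -
    have "?G x - ?G y = of_real (R\<^sup>2) * (x - y)" by (simp only: G) (simp add: algebra_simps)
    then show ?thesis by (simp add: dist_norm norm_mult norm_power)
  qed
  have "\<exists>!z\<in>K. ?G z = z"
    by (rule Banach_fix[of K "R\<^sup>2"]) (use K R_bounds f g lip in \<open>auto simp: compact_imp_complete\<close>)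
  then obtain z where z: "z \<in> K" "?G z = z" by blast
  \<comment> \<open>Uniqueness inside \<open>K\<close> says nothing about \<open>P 1\<close> yet, so
    the two fixed points are compared directly through the scaling factor
    \<open>R\<^sup>2 < 1\<close>.\<close>
  have "dist z (P 1) = R\<^sup>2 * dist z (P 1)" using lip[of z "P 1"] z fixed_point by simp
  then have "z = P 1" using R_bounds by simp
  have P: "P (n + 1) \<in> K" for n
  proof (induction n)
    case 0
    then show ?case using z \<open>z = P 1\<close> by simp
  next
    case (Suc n)
    then show ?case using f[OF Suc] by (simp add: f_P)
  qed
  moreover have Q: "Q n \<in> K" for n using g[OF P[of n]] by (simp only: g_P)
  moreover have "B \<in> K" using g[OF Q[of 1]] by (simp only: g_Q_1)
  moreover have "P n \<in> K" if "1 \<le> n" for n using P[of "n - 1"] that by simp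
  ultimately show ?thesis by (auto simp: candidates_def)
qed

lemma convex_polygon_attractor:
  assumes "attractor K"
  shows "convex_polygon (convex hull K)"
proof -
  obtain V where V: "finite V" "V \<subseteq> candidates" "candidates \<subseteq> convex hull V" "0 \<in> convex hull V"
    and int: "interior (convex hull V) \<noteq> {}"
    using finitely_many_candidates_suffice by metis
  have "K \<subseteq> convex hull V"
    by (rule compact_self_covering_subset[where f = f and g = g and c = "norm a"])
      (use assms V(4) norm_a contractions hull_invariant[OF V] in
        \<open>auto simp: attractor_def intro: compact_imp_closed finite_imp_compact_convex_hull[OF V(1)]\<close>)
  then have "convex hull K \<subseteq> convex hull V" by (simp add: hull_minimal)
  moreover have "convex hull V \<subseteq> convex hull K"
    using V(2) candidates_subset_attractor[OF assms] by (intro hull_mono) auto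
  ultimately have "convex hull K = convex hull V" by blast
  then show ?thesis using V(1) int by (simp add: convex_polygon_def polytope_convex_hull)
qed

end

section \<open>Specialisation to the dragon curve\<close>

lemma dragon_parameter_dragon_a:
  assumes "0 < \<eta>" and "\<eta> < pi / 3"
  shows "dragon_parameter (dragon_a \<eta>)"
proof
  \<comment> \<open>The bound \<open>pi / 3\<close> enters here:
    \<open>norm (dragon_a \<eta>)\<close> is \<open>1 / (2 * cos \<eta>)\<close>.\<close>
  have cos: "1 / 2 < cos \<eta>"
    using cos_monotone_0_pi[of \<eta> "pi / 3"] assms by (simp add: cos_60)
  show "Re (dragon_a \<eta>) = 1 / 2" using cos by (simp add: dragon_a_def)
  have "0 < sin \<eta>" using assms by (intro sin_gt_zero) auto
  then show "Im (dragon_a \<eta>) \<noteq> 0" using cos by (simp add: dragon_a_def)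
  show "norm (dragon_a \<eta>) < 1" using cos by (simp add: dragon_a_def norm_divide)
qed

theorem theorem1p2:
  fixes \<eta> :: real
  assumes "0 < \<eta>" and "\<eta> < pi / 3"
  shows "convex_polygon (convex hull (dragon \<eta>))"
proof -
  interpret dragon_parameter "dragon_a \<eta>"
    using dragon_parameter_dragon_a assms .
  have f: "dragon_f1 \<eta> = f" and g: "dragon_f2 \<eta> = g"
    by (rule ext, simp add: dragon_f1_def f_def) (rule ext, simp add: dragon_f2_def g_def)
  have "attractor = (\<lambda>K. compact K \<and> K \<noteq> {} \<and> K = f ` K \<union> g ` K)"
    by (rule ext) (rule attractor_def)
  then have "dragon \<eta> = The attractor"
    unfolding dragon_def f g by (rule arg_cong[OF sym])
  moreover obtain K where K: "attractor K" using attractor_exists ..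
  then have "The attractor = K" using attractor_unique[OF _ K] by (rule the_equality)
  ultimately show ?thesis using convex_polygon_attractor[OF K] by simp
qed

end
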